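(* Let $C\subset\mathbb{R}^n$ be nonempty, closed and convex and let $D=\{x\in\mathbb{R}^n: Ax=b\}$ be a nonempty affine set, where $A$ is a linear operator. Suppose that $\alpha_1\in(0,2]$ and $\alpha_2\in(0,2]$. Then the GAP envelope $F=F_{\alpha_1,\alpha_2}^{\mathrm{GAP}}$ (defined in the context) satisfies, for all $x,y\in\mathbb{R}^n$, $$\tfrac12\langle M(x-y),x-y\rangle\le F(x)-F(y)-\langle\nabla F(y),x-y\rangle\le\tfrac12\langle L(x-y),x-y\rangle,$$ where $$M=\alpha_1(1-\alpha_1)(\mathrm{Id}-N),$$ $$L=(1-\alpha_1)\big(1+(\alpha_2-1)(1-\alpha_1)\big)\mathrm{Id}+\alpha_1\big(1+(\alpha_2-1)(2-\alpha_1)\big)N,$$ and $N$ is the orthogonal projection onto $D_0=\{x\in\mathbb{R}^n:Ax=0\}$.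
   Context: $\langle\cdot,\cdot\rangle$ is an inner product on $\mathbb{R}^n$ with induced norm $\|\cdot\|$; $\Pi_C$ is the projection onto a nonempty closed convex set $C$ and $\iota_C$ its indicator function. Put $r_C(x)=\iota_C(x)+\tfrac12\|x\|^2$, with conjugate $r_C^*(y)=\sup_x\{\langle y,x\rangle-r_C(x)\}$, for which $\nabla r_C^*=\Pi_C$. Define $p_C^\alpha(x)=\alpha r_C^*(x)+\tfrac{1-\alpha}2\|x\|^2$ and the relaxed projection $P_C^\alpha(x)=\nabla p_C^\alpha(x)=\alpha\Pi_C(x)+(1-\alpha)x$. With $N=\Pi_{D_0}$, let $P=(1-\alpha_1)\mathrm{Id}+\alpha_1N$ (the linear part of the affine map $P_D^{\alpha_1}$). The GAP (generalized alternating projections) envelope is $$F_{\alpha_1,\alpha_2}^{\mathrm{GAP}}(x)=\tfrac12\langle Px,x\rangle-p_C^{\alpha_2}(P_D^{\alpha_1}x).$$ *)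

theory Defs
  imports "HOL-Analysis.Analysis"
begin

definition convex_indicator :: "'a set \<Rightarrow> 'a \<Rightarrow> ereal" where
  "convex_indicator C x = (if x \<in> C then 0 else \<infinity>)"

definition conjugate :: "('a::euclidean_space \<Rightarrow> ereal) \<Rightarrow> 'a \<Rightarrow> ereal" where
  "conjugate f y = (SUP x. ereal (y \<bullet> x) - f x)"

definition r_fun :: "'a::euclidean_space set \<Rightarrow> 'a \<Rightarrow> ereal" where
  "r_fun C x = convex_indicator C x + ereal (1/2 * (norm x)\<^sup>2)"

text \<open>Since \<open>r_fun\<close> is strongly convex, its conjugate is finite everywhere when \<open>C\<close> is nonempty
  (lemma \<open>conjugate_r_fun_finite\<close> below), so \<^const>\<open>real_of_ereal\<close> loses nothing there.\<close>

definition p_fun :: "real \<Rightarrow> 'a::euclidean_space set \<Rightarrow> 'a \<Rightarrow> real" where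
  "p_fun \<alpha> C x = \<alpha> * real_of_ereal (conjugate (r_fun C) x) + (1 - \<alpha>) / 2 * (norm x)\<^sup>2"

definition relaxed_proj :: "real \<Rightarrow> 'a::euclidean_space set \<Rightarrow> 'a \<Rightarrow> 'a" where
  "relaxed_proj \<alpha> C x = \<alpha> *\<^sub>R closest_point C x + (1 - \<alpha>) *\<^sub>R x"

definition solution_set :: "('a \<Rightarrow> 'b) \<Rightarrow> 'b \<Rightarrow> 'a set" where
  "solution_set A b = {x. A x = b}"

text \<open>With \<open>D = solution_set A b\<close>, the direction space \<open>D\<^sub>0\<close> is \<open>solution_set A 0\<close>, and
  \<open>gap_linear_part\<close> is the linear part of the affine map \<open>relaxed_proj \<alpha>1 D\<close>.\<close>

definition gap_linear_part ::
  "real \<Rightarrow> ('a::euclidean_space \<Rightarrow> 'b::real_vector) \<Rightarrow> 'a \<Rightarrow> 'a" where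
  "gap_linear_part \<alpha>1 A x = (1 - \<alpha>1) *\<^sub>R x + \<alpha>1 *\<^sub>R closest_point (solution_set A 0) x"

definition gap_envelope ::
  "real \<Rightarrow> real \<Rightarrow> 'a::euclidean_space set \<Rightarrow> ('a \<Rightarrow> 'b::real_vector) \<Rightarrow> 'b \<Rightarrow> 'a \<Rightarrow> real" where
  "gap_envelope \<alpha>1 \<alpha>2 C A b x =
     1/2 * (gap_linear_part \<alpha>1 A x \<bullet> x) - p_fun \<alpha>2 C (relaxed_proj \<alpha>1 (solution_set A b) x)"

text \<open>Meaningful only at points of differentiability; \<open>GDERIV\<close> is Frechet differentiability
  with the derivative represented through the inner product.\<close>

definition gradient :: "('a::euclidean_space \<Rightarrow> real) \<Rightarrow> 'a \<Rightarrow> 'a" where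
  "gradient f x = (THE g. GDERIV f x :> g)"

lemma gradient_eq:
  assumes "GDERIV f x :> g"
  shows "gradient f x = g"
  unfolding gradient_def
proof (rule the_equality)
  show "GDERIV f x :> g" by (rule assms)
next
  fix h assume "GDERIV f x :> h"
  with assms have "(\<lambda>z. z \<bullet> h) = (\<lambda>z. z \<bullet> g)"
    unfolding gderiv_def by (metis has_derivative_unique)
  then show "h = g"
    by (metis vector_eq_ldot)
qed

lemma conjugate_r_fun_finite:
  fixes C :: "'a::euclidean_space set"
  assumes "C \<noteq> {}"
  shows "\<bar>conjugate (r_fun C) y\<bar> \<noteq> \<infinity>"
proof -
  have "ereal (y \<bullet> x) - r_fun C x \<le> ereal (1/2 * (norm y)\<^sup>2)" for x
  proof -
    have "0 \<le> (norm (y - x))\<^sup>2" by simp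
    then have "y \<bullet> x - 1/2 * (norm x)\<^sup>2 \<le> 1/2 * (norm y)\<^sup>2"
      by (simp add: power2_norm_eq_inner inner_diff inner_commute)
    then show ?thesis
      by (auto simp: r_fun_def convex_indicator_def)
  qed
  then have upper: "conjugate (r_fun C) y \<le> ereal (1/2 * (norm y)\<^sup>2)"
    unfolding conjugate_def by (intro SUP_least) auto
  obtain c where c: "c \<in> C" using assms by blast
  have "ereal (y \<bullet> c - 1/2 * (norm c)\<^sup>2) = ereal (y \<bullet> c) - r_fun C c"
    using c by (simp add: r_fun_def convex_indicator_def)
  also have "\<dots> \<le> conjugate (r_fun C) y"
    unfolding conjugate_def by (rule SUP_upper) simp
  finally have lower: "ereal (y \<bullet> c - 1/2 * (norm c)\<^sup>2) \<le> conjugate (r_fun C) y" .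
  from upper lower show ?thesis
    by (cases "conjugate (r_fun C) y") auto
qed

end

theory Submission
  imports Defs
begin

text \<open>The function \<open>p\<^sub>C\<^sup>\<alpha>\<close> has gradient \<open>P\<^sub>C\<^sup>\<alpha>\<close>, and its first-order remainder between \<open>v\<close> and \<open>u\<close>
  lies between \<open>(1 - \<alpha>)/2 \<parallel>u - v\<parallel>\<^sup>2\<close> and \<open>1/2 \<parallel>u - v\<parallel>\<^sup>2\<close>, because the remainder of \<open>r\<^sub>C\<^sup>*\<close>
  lies between \<open>0\<close> and \<open>1/2 \<parallel>u - v\<parallel>\<^sup>2\<close>. Since \<open>P\<^sub>D\<^sup>\<alpha>\<^sup>1\<close> is affine with self-adjoint linear part \<open>P\<close>, the
  remainder of \<open>F\<close> in direction \<open>d\<close> lies between \<open>1/2 \<langle>(P - P\<^sup>2) d, d\<rangle>\<close> and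
  \<open>1/2 \<langle>(P + (\<alpha>2 - 1) P\<^sup>2) d, d\<rangle>\<close>. Because \<open>N\<^sup>2 = N\<close>, these operators are \<open>M\<close> and \<open>L\<close>.\<close>

section \<open>Differentiability from a quadratic bound\<close>

text \<open>Dividing the remainder by \<open>norm (x - y)\<close> leaves at most
  \<open>K * norm (x - y)\<close>, which tends to 0. A two-sided quadratic estimate thus identifies
  the gradient, so the bounds on F also yield its differentiability.\<close>

lemma GDERIV_quadratic_remainder:
  fixes f :: "'a::euclidean_space \<Rightarrow> real"
  assumes "\<And>x. \<bar>f x - f y - g \<bullet> (x - y)\<bar> \<le> K * (norm (x - y))\<^sup>2"
  shows "GDERIV f y :> g"
  unfolding gderiv_def has_derivative_at_within
proof (intro conjI)
  show "bounded_linear (\<lambda>h. h \<bullet> g)" by (rule bounded_linear_inner_left)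
  show "((\<lambda>x. (f x - f y - (x - y) \<bullet> g) /\<^sub>R norm (x - y)) \<longlongrightarrow> 0) (at y)"
  proof (rule Lim_null_comparison)
    show "((\<lambda>x. K * norm (x - y)) \<longlongrightarrow> 0) (at y)"
      by (auto intro!: tendsto_eq_intros)
    show "\<forall>\<^sub>F x in at y. norm ((f x - f y - (x - y) \<bullet> g) /\<^sub>R norm (x - y)) \<le> K * norm (x - y)"
    proof (rule eventuallyI)
      fix x
      show "norm ((f x - f y - (x - y) \<bullet> g) /\<^sub>R norm (x - y)) \<le> K * norm (x - y)"
        using assms[of x]
        by (cases "x = y") (simp_all add: inner_commute abs_mult divide_simps power2_eq_square mult_ac)
    qed
  qed
qed

section \<open>The conjugate of \<open>r_fun\<close> and relaxed projections\<close>

text \<open>On C the objective equals 1/2 |y|^2 - 1/2 |y - x|^2, so maximising it means minimising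
  the distance to y; the projection attains the supremum.\<close>

lemma conjugate_r_fun_eq:
  assumes "closed C" "C \<noteq> {}"
  shows "conjugate (r_fun C) y =
    ereal (y \<bullet> closest_point C y - 1/2 * (norm (closest_point C y))\<^sup>2)"
  unfolding conjugate_def
proof (rule SUP_eqI)
  fix x
  show "ereal (y \<bullet> x) - r_fun C x
    \<le> ereal (y \<bullet> closest_point C y - 1/2 * (norm (closest_point C y))\<^sup>2)"
  proof (cases "x \<in> C")
    case True
    then have "(dist y (closest_point C y))\<^sup>2 \<le> (dist y x)\<^sup>2"
      using closest_point_le[OF assms(1) True, of y] by (simp add: power_mono)
    with True show ?thesis
      by (simp add: r_fun_def convex_indicator_def dist_norm power2_norm_eq_inner
          inner_diff inner_commute)
  qed (simp add: r_fun_def convex_indicator_def)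
next
  fix u assume "\<And>x. x \<in> UNIV \<Longrightarrow> ereal (y \<bullet> x) - r_fun C x \<le> u"
  from this[of "closest_point C y"]
  show "ereal (y \<bullet> closest_point C y - 1/2 * (norm (closest_point C y))\<^sup>2) \<le> u"
    using closest_point_in_set[OF assms, of y] by (simp add: r_fun_def convex_indicator_def)
qed

text \<open>With p and q the projections of v and u, the remainder equals (u - q).(q - p) + 1/2 |q -
  p|^2. The variational inequality at q makes it nonnegative.\<close>

lemma conjugate_r_fun_remainder:
  fixes u v :: "'a::euclidean_space"
  assumes "closed C" "convex C" "C \<noteq> {}"
  defines "s \<equiv> \<lambda>x. real_of_ereal (conjugate (r_fun C) x)"
  shows "0 \<le> s u - s v - closest_point C v \<bullet> (u - v)"
    and "s u - s v - closest_point C v \<bullet> (u - v) \<le> 1/2 * (norm (u - v))\<^sup>2"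
proof -
  define p q where "p = closest_point C v" and "q = closest_point C u"
  have pq: "p \<in> C" "q \<in> C"
    using closest_point_in_set assms unfolding p_def q_def by auto
  have s: "s u = u \<bullet> q - 1/2 * (q \<bullet> q)" "s v = v \<bullet> p - 1/2 * (p \<bullet> p)"
    using assms by (simp_all add: s_def p_def q_def conjugate_r_fun_eq power2_norm_eq_inner)
  have "(u - q) \<bullet> (p - q) \<le> 0" "(v - p) \<bullet> (q - p) \<le> 0"
    using closest_point_dot[OF assms(2,1)] pq unfolding p_def q_def by blast+
  \<comment> \<open>For the upper bound, the inequality at p gives (u - q).(q - p) <= (u - v).(q -
    p) - |q - p|^2. Completing the square then bounds the remainder by 1/2 |u - v|^2 - 1/2 |u - v -
    (q - p)|^2.\<close>
  moreover have "0 \<le> (p - q) \<bullet> (p - q)" "0 \<le> (u - v - (q - p)) \<bullet> (u - v - (q - p))"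
    by simp_all
  ultimately show "0 \<le> s u - s v - closest_point C v \<bullet> (u - v)"
    and "s u - s v - closest_point C v \<bullet> (u - v) \<le> 1/2 * (norm (u - v))\<^sup>2"
    unfolding s power2_norm_eq_inner p_def[symmetric]
    by (simp_all add: inner_diff inner_commute)
qed

text \<open>The remainder of the square term is exact, so only \<alpha> times the conjugate's
  remainder R is estimated. At the upper end the weights add up to \<alpha>/2 + (1 - \<alpha>)/2 =
  1/2.\<close>

lemma p_fun_remainder:
  fixes u v :: "'a::euclidean_space"
  assumes "closed C" "convex C" "C \<noteq> {}" "0 \<le> \<alpha>"
  shows "(1 - \<alpha>) / 2 * (norm (u - v))\<^sup>2
      \<le> p_fun \<alpha> C u - p_fun \<alpha> C v - relaxed_proj \<alpha> C v \<bullet> (u - v)"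
    and "p_fun \<alpha> C u - p_fun \<alpha> C v - relaxed_proj \<alpha> C v \<bullet> (u - v) \<le> 1/2 * (norm (u - v))\<^sup>2"
proof -
  define R where "R = real_of_ereal (conjugate (r_fun C) u) - real_of_ereal (conjugate (r_fun C) v)
    - closest_point C v \<bullet> (u - v)"
  have R: "0 \<le> R" "R \<le> 1/2 * (norm (u - v))\<^sup>2"
    using conjugate_r_fun_remainder[OF assms(1-3)] unfolding R_def by blast+
  have eq: "p_fun \<alpha> C u - p_fun \<alpha> C v - relaxed_proj \<alpha> C v \<bullet> (u - v)
    = \<alpha> * R + (1 - \<alpha>) / 2 * (norm (u - v))\<^sup>2"
    unfolding R_def p_fun_def relaxed_proj_def power2_norm_eq_inner
    by (simp add: inner_diff inner_add inner_commute field_simps)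
  show "(1 - \<alpha>) / 2 * (norm (u - v))\<^sup>2
      \<le> p_fun \<alpha> C u - p_fun \<alpha> C v - relaxed_proj \<alpha> C v \<bullet> (u - v)"
    unfolding eq using R(1) assms(4) by simp
  show "p_fun \<alpha> C u - p_fun \<alpha> C v - relaxed_proj \<alpha> C v \<bullet> (u - v) \<le> 1/2 * (norm (u - v))\<^sup>2"
    unfolding eq using mult_left_mono[OF R(2) assms(4)] by (simp add: field_simps)
qed

section \<open>Projections onto affine sets\<close>

text \<open>The variational inequality, tested in the directions s and -s, becomes an
  equality.\<close>

lemma closest_point_orthogonal:
  fixes a :: "'a::euclidean_space"
  assumes "convex T" "closed T" "closest_point T a + s \<in> T" "closest_point T a - s \<in> T"
  shows "(a - closest_point T a) \<bullet> s = 0"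
  using closest_point_dot[OF assms(1,2,3), of a] closest_point_dot[OF assms(1,2,4), of a] by simp

text \<open>By Pythagoras, |a - z|^2 = |a - p|^2 + |z - p|^2 for z in T.\<close>

lemma closest_point_eqI:
  fixes a :: "'a::euclidean_space"
  assumes "convex T" "closed T" "p \<in> T" "\<And>z. z \<in> T \<Longrightarrow> (a - p) \<bullet> (z - p) = 0"
  shows "p = closest_point T a"
proof (rule closest_point_unique[OF assms(1-3)], rule ballI)
  fix z assume "z \<in> T"
  then have "(dist a p)\<^sup>2 \<le> (dist a z)\<^sup>2"
    using assms(4)[of z] inner_ge_zero[of "z - p"]
    by (simp add: dist_norm power2_norm_eq_inner inner_diff inner_commute)
  then show "dist a p \<le> dist a z" by (simp add: power2_le_iff_abs_le)
qed

context
  fixes A :: "'a::euclidean_space \<Rightarrow> 'b::real_vector"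
  assumes A: "linear A"
begin

lemma convex_solution_set: "convex (solution_set A b)"
  using A by (auto simp: convex_def solution_set_def linear_add linear_scale
      simp flip: scaleR_add_left)

lemma closed_solution_set: "closed (solution_set A b)"
proof (cases "solution_set A b = {}")
  case False
  then obtain c where c: "A c = b" by (auto simp: solution_set_def)
  \<comment> \<open>The codomain carries no topology, so closedness is obtained from the kernel: a
    subspace of a Euclidean space is closed, and so are its translates.\<close>
  have "solution_set A b = (+) c ` {x. A x = 0}"
  proof (intro equalityI subsetI)
    fix x assume "x \<in> solution_set A b"
    then show "x \<in> (+) c ` {x. A x = 0}"
      using c A by (intro image_eqI[of _ _ "x - c"]) (auto simp: solution_set_def linear_diff)
  qed (use c A in \<open>auto simp: solution_set_def linear_add\<close>)
  then show ?thesis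
    using closed_subspace[OF linear_subspace_kernel[OF A]] by (simp add: closed_translation)
qed simp

lemma closest_point_solution_set:
  assumes "solution_set A b \<noteq> {}"
  shows "A (closest_point (solution_set A b) x) = b"
    and "A s = 0 \<Longrightarrow> (x - closest_point (solution_set A b) x) \<bullet> s = 0"
proof -
  show *: "A (closest_point (solution_set A b) x) = b"
    using closest_point_in_set[OF closed_solution_set assms] by (simp add: solution_set_def)
  assume "A s = 0"
  with * A show "(x - closest_point (solution_set A b) x) \<bullet> s = 0"
    by (intro closest_point_orthogonal convex_solution_set closed_solution_set)
      (simp_all add: solution_set_def linear_add linear_diff)
qed

lemma kernel_proj:
  shows "A (closest_point (solution_set A 0) x) = 0"
    and "A s = 0 \<Longrightarrow> (x - closest_point (solution_set A 0) x) \<bullet> s = 0"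
proof -
  have "solution_set A 0 \<noteq> {}"
    using A by (auto simp: solution_set_def intro: linear_0)
  then show "A (closest_point (solution_set A 0) x) = 0"
    and "A s = 0 \<Longrightarrow> (x - closest_point (solution_set A 0) x) \<bullet> s = 0"
    using closest_point_solution_set by blast+
qed

text \<open>Both sides equal the inner product of the two projections, since residuals are
  orthogonal to the kernel.\<close>

lemma kernel_proj_selfadjoint:
  "closest_point (solution_set A 0) x \<bullet> z = x \<bullet> closest_point (solution_set A 0) z"
  using kernel_proj(2)[OF kernel_proj(1)[of z], of x] kernel_proj(2)[OF kernel_proj(1)[of x], of z]
  by (simp add: inner_diff inner_commute)

text \<open>This is N^2 = N in the form in which it enters the quadratic forms.\<close>

lemma kernel_proj_inner:
  "closest_point (solution_set A 0) x \<bullet> closest_point (solution_set A 0) x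
    = closest_point (solution_set A 0) x \<bullet> x"
  using kernel_proj(2)[OF kernel_proj(1)[of x], of x] by (simp add: inner_diff inner_commute)

lemma kernel_proj_le:
  "closest_point (solution_set A 0) x \<bullet> x \<le> (norm x)\<^sup>2"
proof -
  let ?n = "closest_point (solution_set A 0) x"
  have "0 \<le> (x - ?n) \<bullet> (x - ?n)" by simp
  then show ?thesis
    using kernel_proj_inner[of x] by (simp add: power2_norm_eq_inner inner_diff inner_commute)
qed

lemma closest_point_solution_set_diff:
  assumes "solution_set A b \<noteq> {}"
  shows "closest_point (solution_set A b) x - closest_point (solution_set A b) y
    = closest_point (solution_set A 0) (x - y)"
proof -
  let ?p = "closest_point (solution_set A b) y" and ?n = "closest_point (solution_set A 0) (x - y)"
  have "?p + ?n = closest_point (solution_set A b) x"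
  proof (rule closest_point_eqI[OF convex_solution_set closed_solution_set])
    show *: "?p + ?n \<in> solution_set A b"
      using closest_point_solution_set(1)[OF assms] kernel_proj(1) A
      by (simp add: solution_set_def linear_add)
    fix z assume "z \<in> solution_set A b"
    with * have 0: "A (z - (?p + ?n)) = 0"
      using A by (simp add: solution_set_def linear_diff)
    \<comment> \<open>The residual of the candidate is a sum of two projection residuals, each
      orthogonal to the kernel.\<close>
    have "x - (?p + ?n) = (y - ?p) + (x - y - ?n)" by simp
    then show "(x - (?p + ?n)) \<bullet> (z - (?p + ?n)) = 0"
      using closest_point_solution_set(2)[OF assms 0] kernel_proj(2)[OF 0]
      by (metis add.right_neutral inner_add_left)
  qed
  then show ?thesis by (simp add: algebra_simps)
qed

lemma kernel_proj_diff:
  "closest_point (solution_set A 0) (x - y)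
    = closest_point (solution_set A 0) x - closest_point (solution_set A 0) y"
proof -
  have "solution_set A 0 \<noteq> {}"
    using A by (auto simp: solution_set_def intro: linear_0)
  from closest_point_solution_set_diff[OF this] show ?thesis by simp
qed

section \<open>The linear part P and the remainder of the envelope\<close>

lemma gap_linear_part_diff:
  "gap_linear_part \<alpha> A (x - y) = gap_linear_part \<alpha> A x - gap_linear_part \<alpha> A y"
  unfolding gap_linear_part_def kernel_proj_diff by (simp add: algebra_simps)

lemma gap_linear_part_selfadjoint:
  "gap_linear_part \<alpha> A x \<bullet> z = x \<bullet> gap_linear_part \<alpha> A z"
  unfolding gap_linear_part_def using kernel_proj_selfadjoint[of x z]
  by (simp add: inner_add)

lemma relaxed_proj_solution_set_diff:
  assumes "solution_set A b \<noteq> {}"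
  shows "relaxed_proj \<alpha> (solution_set A b) x - relaxed_proj \<alpha> (solution_set A b) y
    = gap_linear_part \<alpha> A (x - y)"
  unfolding relaxed_proj_def gap_linear_part_def
    closest_point_solution_set_diff[OF assms, symmetric]
  by (simp add: algebra_simps)

lemma norm_gap_linear_part:
  "(norm (gap_linear_part \<alpha> A d))\<^sup>2
    = (1 - \<alpha>)\<^sup>2 * (norm d)\<^sup>2 + \<alpha> * (2 - \<alpha>) * (closest_point (solution_set A 0) d \<bullet> d)"
  unfolding gap_linear_part_def power2_norm_eq_inner
  using kernel_proj_inner[of d]
  by (simp add: inner_add inner_commute power2_eq_square algebra_simps)

text \<open>\<open>g\<close> is the gradient that the chain rule predicts, the adjoint of P being P
  itself. No differentiability is used here: the bounds are purely algebraic.\<close>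

lemma gap_envelope_remainder:
  fixes C :: "'a set" and b :: 'b and \<alpha>1 \<alpha>2 :: real
  assumes C: "closed C" "convex C" "C \<noteq> {}" and \<alpha>2: "0 \<le> \<alpha>2"
    and ne: "solution_set A b \<noteq> {}"
  defines "F \<equiv> gap_envelope \<alpha>1 \<alpha>2 C A b"
    and "P \<equiv> gap_linear_part \<alpha>1 A"
  defines "g \<equiv> \<lambda>y. P y - P (relaxed_proj \<alpha>2 C (relaxed_proj \<alpha>1 (solution_set A b) y))"
  shows "1/2 * (P (x - y) \<bullet> (x - y)) - 1/2 * (norm (P (x - y)))\<^sup>2
      \<le> F x - F y - g y \<bullet> (x - y)"
    and "F x - F y - g y \<bullet> (x - y)
      \<le> 1/2 * (P (x - y) \<bullet> (x - y)) - (1 - \<alpha>2) / 2 * (norm (P (x - y)))\<^sup>2"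
proof -
  define u v where "u = relaxed_proj \<alpha>1 (solution_set A b) x"
    and "v = relaxed_proj \<alpha>1 (solution_set A b) y"
  have uv: "u - v = P (x - y)"
    unfolding u_def v_def P_def by (rule relaxed_proj_solution_set_diff[OF ne])
  have adj: "P a \<bullet> c = a \<bullet> P c" for a c
    unfolding P_def by (rule gap_linear_part_selfadjoint)
  \<comment> \<open>Self-adjointness moves the outer P of \<open>g\<close> onto x - y, turning it
    into u - v.\<close>
  have "g y \<bullet> (x - y) = P y \<bullet> (x - y) - relaxed_proj \<alpha>2 C v \<bullet> (u - v)"
    unfolding g_def v_def[symmetric] uv using adj by (simp add: inner_diff_left)
  moreover have "P (x - y) = P x - P y"
    unfolding P_def by (rule gap_linear_part_diff)
  then have "1/2 * (P x \<bullet> x) - 1/2 * (P y \<bullet> y) - P y \<bullet> (x - y) = 1/2 * (P (x - y) \<bullet> (x - y))"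
    using adj[of x y] by (simp add: inner_diff inner_commute)
  ultimately have eq: "F x - F y - g y \<bullet> (x - y) = 1/2 * (P (x - y) \<bullet> (x - y))
    - (p_fun \<alpha>2 C u - p_fun \<alpha>2 C v - relaxed_proj \<alpha>2 C v \<bullet> (u - v))"
    unfolding F_def gap_envelope_def u_def[symmetric] v_def[symmetric] P_def[symmetric] by simp
  \<comment> \<open>\<open>p_fun\<close> enters F with a minus sign, so its upper bound gives the
    lower bound for F and vice versa.\<close>
  note bounds = p_fun_remainder[OF C \<alpha>2, of u v]
  show "1/2 * (P (x - y) \<bullet> (x - y)) - 1/2 * (norm (P (x - y)))\<^sup>2
      \<le> F x - F y - g y \<bullet> (x - y)"
    using bounds(2) unfolding eq uv by linarith
  show "F x - F y - g y \<bullet> (x - y)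
      \<le> 1/2 * (P (x - y) \<bullet> (x - y)) - (1 - \<alpha>2) / 2 * (norm (P (x - y)))\<^sup>2"
    using bounds(1) unfolding eq uv by linarith
qed

end

section \<open>Identification of M and L, and differentiability\<close>

theorem proposition5p2:
  fixes C :: "'a::euclidean_space set"
    and A :: "'a \<Rightarrow> 'b::real_vector" and b :: 'b
    and \<alpha>1 \<alpha>2 :: real
    and N M L :: "'a \<Rightarrow> 'a" and F :: "'a \<Rightarrow> real"
  assumes "C \<noteq> {}" and "closed C" and "convex C"
    and "linear A" and "solution_set A b \<noteq> {}"
    and "\<alpha>1 \<in> {0<..2}" and "\<alpha>2 \<in> {0<..2}"
    and "F = gap_envelope \<alpha>1 \<alpha>2 C A b"
    and "N = closest_point {x. A x = 0}"
    and "M = (\<lambda>z. (\<alpha>1 * (1 - \<alpha>1)) *\<^sub>R (z - N z))"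
    and "L = (\<lambda>z. ((1 - \<alpha>1) * (1 + (\<alpha>2 - 1) * (1 - \<alpha>1))) *\<^sub>R z
                 + (\<alpha>1 * (1 + (\<alpha>2 - 1) * (2 - \<alpha>1))) *\<^sub>R N z)"
  shows "\<forall>x y. F differentiable (at y)
     \<and> 1/2 * (M (x - y) \<bullet> (x - y)) \<le> F x - F y - gradient F y \<bullet> (x - y)
     \<and> F x - F y - gradient F y \<bullet> (x - y) \<le> 1/2 * (L (x - y) \<bullet> (x - y))"
proof -
  define P where "P = gap_linear_part \<alpha>1 A"
  define g where "g = (\<lambda>y. P y - P (relaxed_proj \<alpha>2 C (relaxed_proj \<alpha>1 (solution_set A b) y)))"
  have N: "N = closest_point (solution_set A 0)"
    using assms(9) by (simp add: solution_set_def)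
  have P: "P d \<bullet> d = (1 - \<alpha>1) * (norm d)\<^sup>2 + \<alpha>1 * (N d \<bullet> d)" for d
    unfolding P_def gap_linear_part_def N by (simp add: inner_add power2_norm_eq_inner)
  have PP: "(norm (P d))\<^sup>2 = (1 - \<alpha>1)\<^sup>2 * (norm d)\<^sup>2 + \<alpha>1 * (2 - \<alpha>1) * (N d \<bullet> d)" for d
    unfolding P_def N by (rule norm_gap_linear_part[OF assms(4)])
  \<comment> \<open>Comparing the coefficients of |d|^2 and of N d . d shows that M and L have the
    quadratic forms of P - P^2 and P + (\<alpha>2 - 1) P^2.\<close>
  have M: "1/2 * (M d \<bullet> d) = 1/2 * (P d \<bullet> d) - 1/2 * (norm (P d))\<^sup>2" for d
    unfolding P PP assms(10) unfolding power2_norm_eq_inner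
    by (simp add: inner_diff power2_eq_square algebra_simps)
  have L: "1/2 * (L d \<bullet> d) = 1/2 * (P d \<bullet> d) - (1 - \<alpha>2) / 2 * (norm (P d))\<^sup>2" for d
    unfolding P PP assms(11) inner_add_left inner_scaleR_left unfolding power2_norm_eq_inner
    by (simp add: power2_eq_square field_simps)
  have lower: "1/2 * (M (x - y) \<bullet> (x - y)) \<le> F x - F y - g y \<bullet> (x - y)"
    and upper: "F x - F y - g y \<bullet> (x - y) \<le> 1/2 * (L (x - y) \<bullet> (x - y))" for x y
    using gap_envelope_remainder[OF assms(4,2,3,1) _ assms(5), of \<alpha>2 \<alpha>1 x y] assms(7)
    unfolding M L assms(8) g_def P_def by auto
  \<comment> \<open>It remains to identify \<open>g\<close> with the gradient. For this the forms of
    M and L, which may be indefinite, are bounded in absolute value by multiples of |d|^2.\<close>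
  have N_bound: "\<bar>N d \<bullet> d\<bar> \<le> (norm d)\<^sup>2" for d
    using kernel_proj_le[OF assms(4), of d] inner_ge_zero[of "N d"]
    unfolding N kernel_proj_inner[OF assms(4)] by simp
  have comb: "\<bar>c * (norm d)\<^sup>2 + e * (N d \<bullet> d)\<bar> \<le> (\<bar>c\<bar> + \<bar>e\<bar>) * (norm d)\<^sup>2" for c e d
  proof -
    have "\<bar>c * (norm d)\<^sup>2 + e * (N d \<bullet> d)\<bar> \<le> \<bar>c\<bar> * (norm d)\<^sup>2 + \<bar>e\<bar> * \<bar>N d \<bullet> d\<bar>"
      by (rule order_trans[OF abs_triangle_ineq]) (simp add: abs_mult)
    also have "\<dots> \<le> \<bar>c\<bar> * (norm d)\<^sup>2 + \<bar>e\<bar> * (norm d)\<^sup>2"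
      by (intro add_left_mono mult_left_mono N_bound) simp
    finally show ?thesis by (simp add: algebra_simps)
  qed
  define m where "m = \<alpha>1 * (1 - \<alpha>1) / 2"
  define k where "k = (1 - \<alpha>1) * (1 + (\<alpha>2 - 1) * (1 - \<alpha>1)) / 2"
  define l where "l = \<alpha>1 * (1 + (\<alpha>2 - 1) * (2 - \<alpha>1)) / 2"
  have M': "1/2 * (M d \<bullet> d) = m * (norm d)\<^sup>2 + (- m) * (N d \<bullet> d)" for d
    unfolding assms(10) inner_scaleR_left inner_diff_left m_def power2_norm_eq_inner
    by (simp add: field_simps)
  have L': "1/2 * (L d \<bullet> d) = k * (norm d)\<^sup>2 + l * (N d \<bullet> d)" for d
    unfolding assms(11) inner_scaleR_left inner_add_left k_def l_def power2_norm_eq_inner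
    by simp
  have deriv: "GDERIV F y :> g y" for y
  proof (rule GDERIV_quadratic_remainder)
    fix x
    \<comment> \<open>The constant is the sum of the bounds for the two forms; as both are
      nonnegative, it dominates each one-sided estimate.\<close>
    have "0 \<le> (\<bar>m\<bar> + \<bar>- m\<bar>) * (norm (x - y))\<^sup>2" "0 \<le> (\<bar>k\<bar> + \<bar>l\<bar>) * (norm (x - y))\<^sup>2"
      by simp_all
    then show "\<bar>F x - F y - g y \<bullet> (x - y)\<bar>
      \<le> ((\<bar>m\<bar> + \<bar>- m\<bar>) + (\<bar>k\<bar> + \<bar>l\<bar>)) * (norm (x - y))\<^sup>2"
      using lower[of x y] upper[of x y] comb[of m "x - y" "- m"] comb[of k "x - y" l]
      unfolding M' L' distrib_right[of "\<bar>m\<bar> + \<bar>- m\<bar>"] by linarith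
  qed
  have "F differentiable (at y)" for y
    using deriv[of y] unfolding gderiv_def differentiable_def by blast
  with lower upper gradient_eq[OF deriv] show ?thesis by simp
qed

end
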